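(* Let $N\geq 1$ and let $\Omega\subset\mathbb{R}^N$ be a bounded Lipschitz domain containing the origin. Then for every $u\in C_c^\infty(\Omega)$, $$2\int_\Omega\Big(\log\frac1{|x|}\Big)\,u(x)^2\,dx+ d_{N,\Omega}\,\|u\|_{2}^2\leq \|u\|_{\ln}^2,$$ where $$d_{N,\Omega}= 2\psi\Big(\frac N4 \Big)-2\psi\Big(\frac N2 \Big) +1-\gamma-C_N |\Omega|^{\frac12},\qquad C_N=c_N\Big(\int_{\mathbb{R}^N\setminus B_1(0)} |y|^{-2N}\,dy\Big)^{\frac12}.$$
   Context: $C_c^\infty(\Omega)$ is the set of smooth real functions on $\mathbb{R}^N$ with compact support contained in $\Omega$ (so they vanish outside $\Omega$). $|\Omega|$ is the Lebesgue measure of $\Omega$, $B_1(0)$ is the open unit ball, and $\|u\|_2=\big(\int_\Omega u(x)^2dx\big)^{1/2}$. $\Gamma$ is the Gamma function, $\psi=\Gamma'/\Gamma$ is the Digamma function, $\gamma=-\Gamma'(1)$ is the Euler--Mascheroni constant, and $$c_N=\frac{\Gamma(\frac N2)}{\pi^{\frac N2}}.$$ The norm $\|\cdot\|_{\ln}$ is $$\|u\|_{\ln}=\Big(c_N\iint_{\{x,y\in\mathbb{R}^N:\,|x-y|<1\}}\frac{(u(x)-u(y))^2}{|x-y|^{N}}\,dx\,dy +\int_{\Omega} u(x)^2\,dx\Big)^{\frac12}.$$ $\log$ is the natural logarithm. *)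

theory Defs
  imports "HOL-Analysis.Analysis"
begin

text \<open>
  Throughout, \<open>\<real>\<^sup>N\<close> is an arbitrary type \<open>'a :: euclidean_space\<close> with \<open>N = DIM('a)\<close>, which is at least 1.
\<close>

text \<open>
  Near each boundary point, and after the rotation that turns the last coordinate axis into the
  direction \<open>e\<close>, the set is the strict epigraph of a Lipschitz function of the remaining
  coordinates, that is, of the orthogonal projection \<open>x - (x \<bullet> e) *\<^sub>R e\<close> to the hyperplane
  orthogonal to \<open>e\<close>.  In dimension 1 that hyperplane is \<open>{0}\<close>.
\<close>

definition lipschitz_domain :: "'a::euclidean_space set \<Rightarrow> bool" where
  "lipschitz_domain \<Omega> \<longleftrightarrow>
     open \<Omega> \<and> connected \<Omega> \<and> \<Omega> \<noteq> {} \<and>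
     (\<forall>p\<in>frontier \<Omega>. \<exists>r>0. \<exists>e g L. norm e = 1 \<and> L-lipschitz_on {z. z \<bullet> e = 0} g \<and>
        \<Omega> \<inter> ball p r = {x \<in> ball p r. g (x - (x \<bullet> e) *\<^sub>R e) < x \<bullet> e})"

primrec Ck :: "nat \<Rightarrow> ('a::euclidean_space \<Rightarrow> real) \<Rightarrow> bool" where
  "Ck 0 f \<longleftrightarrow> continuous_on UNIV f"
| "Ck (Suc k) f \<longleftrightarrow>
     (\<forall>x. f differentiable at x) \<and> (\<forall>v. Ck k (\<lambda>x. frechet_derivative f (at x) v))"

definition smooth :: "('a::euclidean_space \<Rightarrow> real) \<Rightarrow> bool" where
  "smooth f \<longleftrightarrow> (\<forall>k. Ck k f)"

definition test_functions :: "'a::euclidean_space set \<Rightarrow> ('a \<Rightarrow> real) set" where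
  "test_functions \<Omega> =
     {u. smooth u \<and> compact (closure {x. u x \<noteq> 0}) \<and> closure {x. u x \<noteq> 0} \<subseteq> \<Omega>}"

definition c_const :: "nat \<Rightarrow> real" where
  "c_const N = Gamma (real N / 2) / pi powr (real N / 2)"

definition L2_norm_on :: "'a::euclidean_space set \<Rightarrow> ('a \<Rightarrow> real) \<Rightarrow> real" where
  "L2_norm_on \<Omega> u = sqrt (LINT x:\<Omega>|lborel. (u x)\<^sup>2)"

text \<open>
  The integrand of the double integral is 0 on the diagonal by the convention \<open>0 / 0 = 0\<close>; the
  diagonal is a null set.  For test functions the double integral converges.
\<close>

definition ln_norm :: "'a::euclidean_space set \<Rightarrow> ('a \<Rightarrow> real) \<Rightarrow> real" where
  "ln_norm \<Omega> u =
     sqrt (c_const DIM('a) *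
             (LINT (x, y):{(x, y). norm (x - y) < 1}|lborel \<Otimes>\<^sub>M lborel.
                (u x - u y)\<^sup>2 / norm (x - y) ^ DIM('a))
           + (LINT x:\<Omega>|lborel. (u x)\<^sup>2))"

definition C_const :: "'a::euclidean_space itself \<Rightarrow> real" where
  "C_const _ = c_const DIM('a) *
     sqrt (LINT y:UNIV - ball (0::'a) 1|lborel. norm y powr (- 2 * real DIM('a)))"

definition d_const :: "'a::euclidean_space set \<Rightarrow> real" where
  "d_const \<Omega> = 2 * Digamma (real DIM('a) / 4) - 2 * Digamma (real DIM('a) / 2) + 1
     - euler_mascheroni - C_const TYPE('a) * sqrt (measure lborel \<Omega>)"

lemma euler_mascheroni_eq_deriv_Gamma: "(euler_mascheroni :: real) = - deriv Gamma 1"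
proof -
  have "(Gamma has_field_derivative Gamma 1 * Digamma 1) (at (1::real))"
    by (rule has_field_derivative_Gamma) auto
  from DERIV_imp_deriv[OF this] show ?thesis
    by (simp add: Digamma_1)
qed

end

theory Submission
  imports Defs
begin

text \<open>
  Fix \<open>b \<ge> 2\<close> and integrate \<open>u(x)\<^sup>2 \<le> 2 (u(x) - u(y))\<^sup>2 + 2 u(y)\<^sup>2\<close> against \<open>|x - y|\<^sup>-\<^sup>N\<close> over the region
  \<open>b |x| < |x - y| < 1\<close>.  For fixed \<open>x\<close> the region is an annulus around \<open>x\<close>, so the left-hand side
  produces the logarithm of \<open>1 / (b |x|)\<close>.  For fixed \<open>y\<close> it lies in a ball of Apollonius, on which the
  kernel has mass at most \<open>|B\<^sub>1| (b - 1)\<^sup>-\<^sup>N\<close>, whatever \<open>y\<close> is.  The region is disjoint from its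
  mirror image under swapping \<open>x\<close> and \<open>y\<close>, so the differences contribute at most the double integral
  in the norm.  For \<open>b = 5/2\<close> the resulting constant \<open>2 log b + (4/N) (2/3)\<^sup>N\<close> is at most
  \<open>1 - d\<close> in every dimension, by the duplication formula for the Digamma function; the
  term of \<open>d\<close> with the volume of \<open>\<Omega>\<close> is needed only through its sign.
\<close>

section \<open>Digamma estimates for the constant\<close>

text \<open>Follows from the limit formula for \<open>Digamma\<close>: the sum of
  \<open>2 * m\<close> terms for \<open>2 * x\<close> splits into even indices, belonging to
  \<open>x\<close>, and odd indices, belonging to \<open>x + 1/2\<close>. The term
  \<open>ln 2\<close> is the difference of \<open>ln (2 * m)\<close> and
  \<open>ln m\<close>.\<close>

lemma Digamma_duplication_real:
  fixes x :: real
  assumes "x > 0"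
  shows "Digamma (2 * x) = ln 2 + (Digamma x + Digamma (x + 1/2)) / 2"
proof -
  have nz: "2 * x \<noteq> 0" "x \<noteq> 0" "x + 1/2 \<noteq> 0"
    using assms by auto
  have sum_eq: "(\<Sum>n<2*m. inverse (2 * x + real n))
      = ((\<Sum>n<m. inverse (x + real n)) + (\<Sum>n<m. inverse (x + 1/2 + real n))) / 2" for m :: nat
  proof (induction m)
    case (Suc m)
    have "inverse (2 * x + 2 * real m) = inverse (x + real m) / 2"
      "inverse (2 * x + (1 + 2 * real m)) = inverse (x + 1/2 + real m) / 2"
      using assms by (simp_all add: divide_simps add_pos_nonneg)
    moreover have "(\<Sum>n<2 * Suc m. inverse (2 * x + real n)) = (\<Sum>n<2*m. inverse (2 * x + real n))
        + inverse (2 * x + 2 * real m) + inverse (2 * x + (1 + 2 * real m))"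
      by simp
    ultimately show ?case using Suc.IH by simp
  qed simp
  have lim2: "filterlim (\<lambda>m::nat. 2 * m) sequentially sequentially"
    by (rule filterlim_subseq) (auto simp: strict_mono_def)
  have "(\<lambda>m. ln (real (2 * m)) - (\<Sum>n<2*m. inverse (2 * x + real n))) \<longlonglongrightarrow> Digamma (2 * x)"
    using filterlim_compose[OF Digamma_LIMSEQ[OF nz(1)] lim2] by simp
  moreover have "(\<lambda>m. ln 2 + ((ln (real m) - (\<Sum>n<m. inverse (x + real n)))
        + (ln (real m) - (\<Sum>n<m. inverse (x + 1/2 + real n)))) / 2)
      \<longlonglongrightarrow> ln 2 + (Digamma x + Digamma (x + 1/2)) / 2"
    using Digamma_LIMSEQ[OF nz(2)] Digamma_LIMSEQ[OF nz(3)]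
    by (intro tendsto_intros) simp_all
  moreover have "\<forall>\<^sub>F m in sequentially. ln 2 + ((ln (real m) - (\<Sum>n<m. inverse (x + real n)))
        + (ln (real m) - (\<Sum>n<m. inverse (x + 1/2 + real n)))) / 2
      = ln (real (2 * m)) - (\<Sum>n<2*m. inverse (2 * x + real n))"
    using eventually_gt_at_top[of 0]
  proof eventually_elim
    case (elim m)
    then have "ln (real (2 * m)) = ln 2 + ln (real m)"
      by (simp add: ln_mult)
    then show ?case by (simp add: sum_eq diff_divide_distrib add_divide_distrib)
  qed
  ultimately show ?thesis
    by (rule LIMSEQ_unique[OF _ Lim_transform_eventually])
qed

text \<open>Duplication reduces the difference to \<open>ln 2\<close> plus half of
  \<open>Digamma (x + 1/2) - Digamma x\<close>. The term beyond \<open>ln 2\<close> is what absorbs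
  the Apollonius error in each dimension.\<close>

lemma Digamma_double_minus_ge:
  fixes x :: real
  assumes "x > 0"
  shows "ln 2 + 1 / (2 * x * (2 * x + 1)) \<le> Digamma (2 * x) - Digamma x"
proof -
  \<comment> \<open>Monotonicity is applied after a shift by 1: returning through the recurrence
    then leaves a positive gain, whereas unshifted it would only give 0.\<close>
  have "Digamma (x + 1) \<le> Digamma (x + 1/2 + 1)"
    using assms by (intro Digamma_real_mono) auto
  then have "1 / x - 1 / (x + 1/2) \<le> Digamma (x + 1/2) - Digamma x"
    using assms Digamma_plus1[of x] Digamma_plus1[of "x + 1/2"] by simp
  moreover have "1 / (2 * x * (2 * x + 1)) = (1 / x - 1 / (x + 1/2)) / 2"
    using assms by (simp add: divide_simps)
  ultimately show ?thesis
    unfolding Digamma_duplication_real[OF assms] by (simp add: field_simps)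
qed

text \<open>Turns the geometric factor \<open>(2/3) ^ n\<close> into \<open>2 / (n + 2)\<close>, the
  shape of the gain in \<open>Digamma_double_minus_ge\<close> at \<open>x = n / 4\<close>. Equality
  holds at \<open>n = 1\<close>, and the left side does not increase because
  \<open>2 * (n + 3) \<le> 3 * (n + 2)\<close>.\<close>

lemma two_thirds_power_le:
  assumes "n \<ge> 1"
  shows "real (n + 2) * (2/3) ^ n \<le> 2"
  using assms
proof (induction n rule: nat_induct_at_least)
  case (Suc n)
  have "real (Suc n + 2) * (2/3) ^ Suc n = (2/3) ^ n * (2 / 3 * real (n + 3))"
    by (simp add: field_simps)
  also have "\<dots> \<le> (2/3) ^ n * real (n + 2)"
    by (rule mult_left_mono) auto
  finally have "real (Suc n + 2) * (2/3) ^ Suc n \<le> real (n + 2) * (2/3) ^ n"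
    by (simp only: mult.commute)
  then show ?case using Suc.IH by (rule order_trans)
qed simp

text \<open>The numerical comparison behind the choice \<open>b = 5/2\<close>: the power term is
  absorbed by the Digamma gain \<open>8 / (n * (n + 2))\<close>, and the excess
  \<open>2 * ln (5/4) \<le> 1/2\<close> by the Euler-Mascheroni constant, which exceeds
  \<open>19/33\<close>.\<close>

lemma Digamma_double_minus_ge_ln:
  assumes "n \<ge> 1"
  shows "2 * ln (5/2) + 4 / real n * (2/3) ^ n
    \<le> 2 * Digamma (real n / 2) - 2 * Digamma (real n / 4) + euler_mascheroni"
proof -
  have "(2/3) ^ n \<le> 2 / (real n + 2)"
    using two_thirds_power_le[OF assms] by (simp add: field_simps)
  then have "4 / real n * (2/3) ^ n \<le> 4 / real n * (2 / (real n + 2))"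
    by (rule mult_left_mono) auto
  also have "\<dots> = 2 * (1 / (2 * (real n / 4) * (2 * (real n / 4) + 1)))"
    using assms by (simp add: divide_simps)
  also have "\<dots> \<le> 2 * (Digamma (real n / 2) - Digamma (real n / 4) - ln 2)"
    using Digamma_double_minus_ge[of "real n / 4"] assms by simp
  finally have *: "4 / real n * (2/3) ^ n \<le> \<dots>" .
  have "ln (5/2 :: real) = ln 2 + ln (5/4)"
    using ln_mult[of 2 "5/4 :: real"] by simp
  moreover have "ln (5/4 :: real) \<le> 1/4"
    using ln_le_minus_one[of "5/4"] by simp
  ultimately show ?thesis
    using * euler_mascheroni_gt_19_over_33 by simp
qed

section \<open>Radial integration and integrals of the kernel\<close>

text \<open>Polar coordinates for radial functions. It suffices to compare the measures on the
  half-lines \<open>{..a}\<close>, where both give the volume of the ball of radius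
  \<open>a\<close>.\<close>

lemma distr_norm_lborel:
  "distr lborel borel (norm :: 'a::euclidean_space \<Rightarrow> real) = density lborel
     (\<lambda>r. ennreal (real DIM('a) * unit_ball_vol DIM('a) * r ^ (DIM('a) - 1)) * indicator {0..} r)"
  (is "?M = density lborel ?g")
proof (rule measure_eqI_generator_eq[where E = "range (\<lambda>a. {..a})" and \<Omega> = UNIV
      and A = "\<lambda>i::nat. {..real i}"])
  have M: "emeasure ?M {..a} = (if a < 0 then 0 else ennreal (unit_ball_vol DIM('a) * a ^ DIM('a)))"
    for a :: real
  proof -
    have "emeasure ?M {..a} = emeasure lborel (norm -` {..a} \<inter> space lborel :: 'a set)"
      by (rule emeasure_distr) auto
    also have "(norm -` {..a} \<inter> space lborel :: 'a set) = cball 0 a"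
      by auto
    finally show ?thesis
      by (simp add: emeasure_cball)
  qed
  show "emeasure ?M X = emeasure (density lborel ?g) X" if "X \<in> range (\<lambda>a. {..a})" for X
  proof -
    from that obtain a where X: "X = {..a}" by auto
    have *: "emeasure (density lborel ?g) X = (\<integral>\<^sup>+r. ?g r * indicator {..a} r \<partial>lborel)"
      unfolding X by (rule emeasure_density) auto
    show ?thesis
    proof (cases "a < 0")
      case True
      then have "(\<integral>\<^sup>+r. ?g r * indicator {..a} r \<partial>lborel) = (\<integral>\<^sup>+r. 0 \<partial>(lborel :: real measure))"
        by (intro nn_integral_cong) (auto split: split_indicator)
      then show ?thesis
        using True M[of a] * by (simp add: X)
    next
      case False
      have "(\<integral>\<^sup>+r. ?g r * indicator {..a} r \<partial>lborel)
          = (\<integral>\<^sup>+r. ennreal (real DIM('a) * unit_ball_vol DIM('a) * r ^ (DIM('a) - 1)) * indicator {0..a} r \<partial>lborel)"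
        by (rule nn_integral_cong) (auto split: split_indicator)
      also have "\<dots> = unit_ball_vol DIM('a) * a ^ DIM('a) - unit_ball_vol DIM('a) * 0 ^ DIM('a)"
        using False by (intro nn_integral_FTC_Icc) (auto intro!: derivative_eq_intros)
      finally show ?thesis
        using False M[of a] * by (simp add: X)
    qed
  qed
  show "Int_stable (range (\<lambda>a::real. {..a}))"
    by (auto simp: Int_stable_def)
  show "emeasure ?M {..real i} \<noteq> \<infinity>" for i :: nat
    unfolding M by simp
  show "(\<Union>i::nat. {..real i}) = UNIV"
    by (auto simp: real_arch_simple)
qed (auto simp: borel_eq_atMost)

lemma nn_integral_lborel_radial:
  assumes [measurable]: "f \<in> borel_measurable borel"
  shows "(\<integral>\<^sup>+z. f (norm (z :: 'a::euclidean_space)) \<partial>lborel) = (\<integral>\<^sup>+r.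
     ennreal (real DIM('a) * unit_ball_vol DIM('a) * r ^ (DIM('a) - 1)) * indicator {0..} r * f r \<partial>lborel)"
proof -
  have "(\<integral>\<^sup>+z. f (norm (z :: 'a)) \<partial>lborel) = (\<integral>\<^sup>+r. f r \<partial>distr lborel borel (norm :: 'a \<Rightarrow> real))"
    by (rule nn_integral_distr[symmetric]) auto
  then show ?thesis
    unfolding distr_norm_lborel by (simp add: nn_integral_density)
qed

lemma nn_integral_annulus_inverse_power:
  assumes "0 < s" "s \<le> 1"
  shows "(\<integral>\<^sup>+z. ennreal (1 / norm (z :: 'a::euclidean_space) ^ DIM('a)) * indicator {s<..<1} (norm z) \<partial>lborel)
    = ennreal (real DIM('a) * unit_ball_vol DIM('a) * ln (1 / s))"
proof -
  let ?w = "real DIM('a) * unit_ball_vol DIM('a)"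
  have "(\<integral>\<^sup>+z. ennreal (1 / norm (z :: 'a) ^ DIM('a)) * indicator {s<..<1} (norm z) \<partial>lborel)
      = (\<integral>\<^sup>+r. ennreal (?w * r ^ (DIM('a) - 1)) * indicator {0..} r * 
          (ennreal (1 / r ^ DIM('a)) * indicator {s<..<1} r) \<partial>lborel)"
    by (subst nn_integral_lborel_radial[symmetric]) auto
  also have "\<dots> = (\<integral>\<^sup>+r. ennreal (?w / r) * indicator {s..1} r \<partial>lborel)"
  proof (rule nn_integral_cong_AE)
    \<comment> \<open>Discarding the two endpoints replaces the open interval by the closed one that
      the fundamental theorem of calculus requires.\<close>
    have "AE r in lborel. r \<noteq> s" "AE r in lborel. r \<noteq> (1::real)"
      by (rule AE_lborel_singleton)+
    then show "AE r in lborel. ennreal (?w * r ^ (DIM('a) - 1)) * indicator {0..} r * 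
          (ennreal (1 / r ^ DIM('a)) * indicator {s<..<1} r) = ennreal (?w / r) * indicator {s..1} r"
    proof eventually_elim
      case (elim r)
      have "r ^ DIM('a) = r * r ^ (DIM('a) - 1)"
        by (simp flip: power_Suc)
      then show ?case
        using elim assms by (auto simp: ennreal_mult'[symmetric] split: split_indicator)
    qed
  qed
  also have "\<dots> = ennreal (?w * ln 1 - ?w * ln s)"
    using assms by (intro nn_integral_FTC_Icc) (auto intro!: derivative_eq_intros)
  finally show ?thesis
    using assms by (simp add: ln_div)
qed

text \<open>In polar coordinates the integrand is a constant times \<open>r\<close>, hence bounded
  on the unit interval. It dominates the singularity of the double integral for Lipschitz
  functions.\<close>

lemma nn_integral_ball_norm_square_over_power:
  "(\<integral>\<^sup>+z. ennreal ((norm z)\<^sup>2 / norm (z :: 'a::euclidean_space) ^ DIM('a)) * indicator {..<1} (norm z) \<partial>lborel) < \<infinity>"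
proof -
  let ?w = "real DIM('a) * unit_ball_vol DIM('a)"
  have "(\<integral>\<^sup>+z. ennreal ((norm z)\<^sup>2 / norm (z :: 'a) ^ DIM('a)) * indicator {..<1} (norm z) \<partial>lborel)
      = (\<integral>\<^sup>+r. ennreal (?w * r ^ (DIM('a) - 1)) * indicator {0..} r * 
          (ennreal (r\<^sup>2 / r ^ DIM('a)) * indicator {..<1} r) \<partial>lborel)"
    by (subst nn_integral_lborel_radial[symmetric]) auto
  also have "\<dots> \<le> (\<integral>\<^sup>+r. ennreal ?w * indicator {0..1} (r::real) \<partial>lborel)"
  proof (rule nn_integral_mono)
    fix r :: real
    have "r ^ DIM('a) = r * r ^ (DIM('a) - 1)"
      by (simp flip: power_Suc)
    then have "?w * r ^ (DIM('a) - 1) * (r\<^sup>2 / r ^ DIM('a)) \<le> ?w" if "0 \<le> r" "r < 1"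
      using that by (cases "r = 0") (auto simp: power2_eq_square mult_left_le)
    then show "ennreal (?w * r ^ (DIM('a) - 1)) * indicator {0..} r * 
          (ennreal (r\<^sup>2 / r ^ DIM('a)) * indicator {..<1} r) \<le> ennreal ?w * indicator {0..1} r"
      by (auto simp: ennreal_mult'[symmetric] ennreal_leI split: split_indicator)
  qed
  also have "\<dots> < \<infinity>"
    by (simp add: nn_integral_cmult ennreal_mult_less_top)
  finally show ?thesis .
qed

lemma nn_integral_lborel_reflect:
  fixes a :: "'a::euclidean_space"
  assumes [measurable]: "f \<in> borel_measurable borel"
  shows "(\<integral>\<^sup>+y. f (a - y) \<partial>lborel) = (\<integral>\<^sup>+z. f z \<partial>lborel)"
proof -
  have "lborel = distr lborel borel (\<lambda>y. a - y)"
    using lborel_affine[of "-1" a] by (simp add: density_1)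
  then have "(\<integral>\<^sup>+z. f z \<partial>lborel) = (\<integral>\<^sup>+z. f z \<partial>distr lborel borel (\<lambda>y. a - y))"
    by simp
  also have "\<dots> = (\<integral>\<^sup>+y. f (a - y) \<partial>lborel)"
    by (simp add: nn_integral_distr)
  finally show ?thesis by simp
qed

text \<open>The region lies in a ball of radius \<open>b * norm y / (b^2 - 1)\<close>, on which
  \<open>norm (x - y)\<close> is at least \<open>b * norm y / (b + 1)\<close>. In the product of
  volume and kernel bound all powers of \<open>norm y\<close> cancel, so the bound is uniform in
  \<open>y\<close>.\<close>

lemma nn_integral_apollonius_ball_le:
  fixes y :: "'a::euclidean_space"
  assumes b: "b > 1" and y: "y \<noteq> 0"
  shows "(\<integral>\<^sup>+x. ennreal (1 / norm (x - y) ^ DIM('a)) * indicator {x. b * norm x < norm (x - y)} x \<partial>lborel)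
    \<le> ennreal (unit_ball_vol DIM('a) / (b - 1) ^ DIM('a))"
proof -
  have b2: "b\<^sup>2 - 1 > 0"
    using b by (simp add: one_less_power)
  define r where "r = b * norm y / (b\<^sup>2 - 1)"
  define c where "c = - (1 / (b\<^sup>2 - 1)) *\<^sub>R y"
  have r: "r > 0"
    using b b2 y by (simp add: r_def)
  have ball: "x \<in> ball c r" and dist: "1 / norm (x - y) \<le> (b + 1) / (b * norm y)"
    if x: "b * norm x < norm (x - y)" for x
  proof -
    have "(b * norm x)\<^sup>2 < (norm (x - y))\<^sup>2"
      using x b by (intro power_strict_mono) auto
    also have "\<dots> = (norm x)\<^sup>2 - 2 * (x \<bullet> y) + (norm y)\<^sup>2"
      by (simp add: power2_norm_eq_inner inner_diff inner_commute)
    finally have "(b\<^sup>2 - 1) * (norm x)\<^sup>2 + 2 * (x \<bullet> y) < (norm y)\<^sup>2"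
      by (simp add: power_mult_distrib algebra_simps)
    \<comment> \<open>Multiplying by \<open>b^2 - 1\<close> prepares completing the square, which
      reveals the centre \<open>c\<close> and the radius \<open>r\<close>.\<close>
    then have "(b\<^sup>2 - 1) * ((b\<^sup>2 - 1) * (norm x)\<^sup>2 + 2 * (x \<bullet> y)) < (b\<^sup>2 - 1) * (norm y)\<^sup>2"
      using b2 by (rule mult_strict_left_mono)
    moreover have "(norm ((b\<^sup>2 - 1) *\<^sub>R x + y))\<^sup>2
        = (b\<^sup>2 - 1) * ((b\<^sup>2 - 1) * (norm x)\<^sup>2 + 2 * (x \<bullet> y)) + (norm y)\<^sup>2"
      by (simp add: power2_norm_eq_inner inner_add inner_commute algebra_simps)
    ultimately have "(norm ((b\<^sup>2 - 1) *\<^sub>R x + y))\<^sup>2 < (b * norm y)\<^sup>2"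
      by (simp add: power_mult_distrib algebra_simps)
    moreover have "0 \<le> b * norm y"
      using b by simp
    ultimately have "norm ((b\<^sup>2 - 1) *\<^sub>R x + y) < b * norm y"
      by (rule power2_less_imp_less)
    moreover have "(b\<^sup>2 - 1) *\<^sub>R x + y = (b\<^sup>2 - 1) *\<^sub>R (x - c)"
      using b2 by (simp add: c_def algebra_simps)
    ultimately have "(b\<^sup>2 - 1) * norm (x - c) < b * norm y"
      using b2 by simp
    then show "x \<in> ball c r"
      using b2 by (simp add: r_def dist_norm norm_minus_commute field_simps)
    have "norm y \<le> norm x + norm (x - y)"
      using norm_triangle_ineq4[of x "x - y"] by simp
    then have "b * norm y \<le> b * norm x + b * norm (x - y)"
      using b mult_left_mono[of "norm y" "norm x + norm (x - y)" b] by (simp add: distrib_left)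
    then have "b * norm y \<le> (b + 1) * norm (x - y)"
      using x by (simp add: algebra_simps)
    moreover have "0 < b * norm y"
      using b y by simp
    moreover have "x \<noteq> y"
      using x b by (auto simp: mult_less_0_iff)
    ultimately show "1 / norm (x - y) \<le> (b + 1) / (b * norm y)"
      by (simp add: field_simps)
  qed
  have "(\<integral>\<^sup>+x. ennreal (1 / norm (x - y) ^ DIM('a)) * indicator {x. b * norm x < norm (x - y)} x \<partial>lborel)
      \<le> (\<integral>\<^sup>+x. ennreal (((b + 1) / (b * norm y)) ^ DIM('a)) * indicator (ball c r) x \<partial>lborel)"
  proof (rule nn_integral_mono)
    fix x
    have "1 / norm (x - y) ^ DIM('a) \<le> ((b + 1) / (b * norm y)) ^ DIM('a)" if "b * norm x < norm (x - y)"
      using power_mono[OF dist[OF that], of "DIM('a)"] by (simp add: power_one_over)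
    then show "ennreal (1 / norm (x - y) ^ DIM('a)) * indicator {x. b * norm x < norm (x - y)} x
        \<le> ennreal (((b + 1) / (b * norm y)) ^ DIM('a)) * indicator (ball c r) x"
      using ball by (auto split: split_indicator intro: ennreal_leI)
  qed
  also have "\<dots> = ennreal (((b + 1) / (b * norm y)) ^ DIM('a) * (unit_ball_vol DIM('a) * r ^ DIM('a)))"
    using r b by (subst nn_integral_cmult_indicator) (simp_all add: emeasure_ball ennreal_mult')
  also have "((b + 1) / (b * norm y)) ^ DIM('a) * (unit_ball_vol DIM('a) * r ^ DIM('a))
      = unit_ball_vol DIM('a) * ((b + 1) / (b * norm y) * r) ^ DIM('a)"
    by (simp only: power_mult_distrib mult_ac)
  also have "(b + 1) / (b * norm y) * r = 1 / (b - 1)"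
  proof -
    have "b\<^sup>2 - 1 = (b - 1) * (b + 1)"
      by (simp add: power2_eq_square algebra_simps)
    then show ?thesis
      using b y by (simp add: r_def)
  qed
  finally show ?thesis
    by (simp add: power_one_over)
qed

section \<open>The logarithmic Hardy inequality\<close>

text \<open>Stated with extended nonnegative integrals, so that Tonelli applies without
  integrability conditions. The logarithm is truncated at 0 because the annulus around
  \<open>x\<close> is empty once \<open>b * norm x \<ge> 1\<close>.\<close>

lemma nn_log_hardy:
  fixes u :: "'a::euclidean_space \<Rightarrow> real"
  assumes [measurable]: "u \<in> borel_measurable borel" and b: "b \<ge> 2"
  shows "(\<integral>\<^sup>+x. ennreal ((u x)\<^sup>2) *
            ennreal (real DIM('a) * unit_ball_vol DIM('a) * max 0 (ln (1 / (b * norm x)))) \<partial>lborel)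
    \<le> (\<integral>\<^sup>+x. \<integral>\<^sup>+y. ennreal ((u x - u y)\<^sup>2 / norm (x - y) ^ DIM('a))
        * indicator {..<1} (norm (x - y)) \<partial>lborel \<partial>lborel)
      + 2 * ennreal (unit_ball_vol DIM('a) / (b - 1) ^ DIM('a)) * (\<integral>\<^sup>+x. ennreal ((u x)\<^sup>2) \<partial>lborel)"
    (is "?P \<le> ?D + 2 * ?A * ?U")
proof -
  define S where "S = {(x :: 'a, y). b * norm x < norm (x - y) \<and> norm (x - y) < 1}"
  define K where "K = (\<lambda>x y :: 'a. ennreal (1 / norm (x - y) ^ DIM('a)))"
  define F where "F = (\<lambda>x y. ennreal ((u x - u y)\<^sup>2 / norm (x - y) ^ DIM('a)))"
  have S: "S \<in> sets (borel \<Otimes>\<^sub>M borel)"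
  proof -
    have "S = {p \<in> space (borel \<Otimes>\<^sub>M borel). b * norm (fst p) < norm (fst p - snd p) \<and> norm (fst p - snd p) < 1}"
      by (auto simp: S_def space_pair_measure)
    then show ?thesis by simp
  qed
  note [measurable] = S
  have [measurable]: "case_prod K \<in> borel_measurable (borel \<Otimes>\<^sub>M borel)"
    "case_prod F \<in> borel_measurable (borel \<Otimes>\<^sub>M borel)"
    unfolding K_def F_def by measurable
  have F: "F x y = ennreal ((u x - u y)\<^sup>2) * K x y" for x y
    by (simp add: F_def K_def ennreal_mult'[symmetric])
  have F_commute: "F y x = F x y" for x y
    by (simp add: F_def norm_minus_commute power2_commute)
  have inner_x: "(\<integral>\<^sup>+y. K x y * indicator S (x, y) \<partial>lborel)
      = ennreal (real DIM('a) * unit_ball_vol DIM('a) * max 0 (ln (1 / (b * norm x))))" if "x \<noteq> 0" for x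
  proof (cases "b * norm x < 1")
    case True
    have "(\<integral>\<^sup>+y. K x y * indicator S (x, y) \<partial>lborel)
        = (\<integral>\<^sup>+y. ennreal (1 / norm (x - y) ^ DIM('a)) * indicator {b * norm x<..<1} (norm (x - y)) \<partial>lborel)"
      by (intro nn_integral_cong) (auto simp: K_def S_def split: split_indicator)
    also have "\<dots> = (\<integral>\<^sup>+z. ennreal (1 / norm (z :: 'a) ^ DIM('a)) * indicator {b * norm x<..<1} (norm z) \<partial>lborel)"
      by (rule nn_integral_lborel_reflect[where f = "\<lambda>z. ennreal (1 / norm z ^ DIM('a))
        * indicator {b * norm x<..<1} (norm z)"]) simp
    also have "\<dots> = ennreal (real DIM('a) * unit_ball_vol DIM('a) * ln (1 / (b * norm x)))"
      using that b True by (intro nn_integral_annulus_inverse_power) auto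
    moreover have "ln (1 / (b * norm x)) \<ge> 0"
      using that b True by (intro ln_ge_zero) (simp add: field_simps)
    ultimately show ?thesis by simp
  next
    case False
    then have "(\<integral>\<^sup>+y. K x y * indicator S (x, y) \<partial>lborel) = (\<integral>\<^sup>+y. 0 \<partial>(lborel :: 'a measure))"
      by (intro nn_integral_cong) (auto simp: S_def split: split_indicator)
    moreover have "ln (1 / (b * norm x)) \<le> 0"
      using that b False by (subst ln_le_zero_iff) (auto simp: field_simps)
    ultimately show ?thesis by simp
  qed
  have inner_y: "(\<integral>\<^sup>+x. K x y * indicator S (x, y) \<partial>lborel) \<le> ?A" if "y \<noteq> 0" for y
  proof -
    have "(\<integral>\<^sup>+x. K x y * indicator S (x, y) \<partial>lborel)
        \<le> (\<integral>\<^sup>+x. ennreal (1 / norm (x - y) ^ DIM('a)) * indicator {x. b * norm x < norm (x - y)} x \<partial>lborel)"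
      by (intro nn_integral_mono) (auto simp: K_def S_def split: split_indicator)
    also have "\<dots> \<le> ?A"
      using b that by (intro nn_integral_apollonius_ball_le) auto
    finally show ?thesis .
  qed
  \<comment> \<open>The formula \<open>inner_x\<close> fails at the origin, where the kernel
    integral is infinite.\<close>
  have AE0: "AE x in lborel. x \<noteq> (0 :: 'a)"
    by (rule AE_lborel_singleton)
  \<comment> \<open>This is where \<open>b \<ge> 2\<close> enters: membership of both pairs would
    give \<open>2 * (norm x + norm y) < 2 * norm (x - y)\<close>, against the triangle
    inequality.\<close>
  have disjoint: "\<not> ((x, y) \<in> S \<and> (y, x) \<in> S)" for x y
  proof
    assume "(x, y) \<in> S \<and> (y, x) \<in> S"
    then have "b * norm x < norm (x - y)" "b * norm y < norm (x - y)"
      by (auto simp: S_def norm_minus_commute)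
    moreover have "2 * norm x \<le> b * norm x" "2 * norm y \<le> b * norm y"
      using b by (auto intro: mult_right_mono)
    moreover have "norm (x - y) \<le> norm x + norm y"
      by (rule norm_triangle_ineq4)
    ultimately show False by linarith
  qed
  \<comment> \<open>By symmetry of \<open>F\<close>, the doubled integral over \<open>S\<close> is
    the integral over \<open>S\<close> and its mirror image together. These are disjoint inside the
    strip \<open>norm (x - y) < 1\<close>, so the factor 2 of the elementary inequality costs
    nothing.\<close>
  have "2 * (\<integral>\<^sup>+x. \<integral>\<^sup>+y. F x y * indicator S (x, y) \<partial>lborel \<partial>lborel)
      = (\<integral>\<^sup>+x. \<integral>\<^sup>+y. F x y * indicator S (x, y) \<partial>lborel \<partial>lborel)
        + (\<integral>\<^sup>+y. \<integral>\<^sup>+x. F x y * indicator S (x, y) \<partial>lborel \<partial>lborel)"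
    by (subst lborel_pair.Fubini'[of "\<lambda>x y. F x y * indicator S (x, y)"]) (simp_all add: mult_2)
  also have "\<dots> = (\<integral>\<^sup>+x. \<integral>\<^sup>+y. F x y * indicator S (x, y) + F x y * indicator S (y, x) \<partial>lborel \<partial>lborel)"
    by (subst (3) F_commute) (simp add: nn_integral_add)
  also have "\<dots> \<le> ?D"
    using disjoint
    by (intro nn_integral_mono) (auto simp: S_def F_def norm_minus_commute split: split_indicator)
  finally have half: "2 * (\<integral>\<^sup>+x. \<integral>\<^sup>+y. F x y * indicator S (x, y) \<partial>lborel \<partial>lborel) \<le> ?D" .
  have "?P = (\<integral>\<^sup>+x. ennreal ((u x)\<^sup>2) * (\<integral>\<^sup>+y. K x y * indicator S (x, y) \<partial>lborel) \<partial>lborel)"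
    by (rule nn_integral_cong_AE, use AE0 in eventually_elim) (simp add: inner_x)
  also have "\<dots> = (\<integral>\<^sup>+x. \<integral>\<^sup>+y. ennreal ((u x)\<^sup>2) * (K x y * indicator S (x, y)) \<partial>lborel \<partial>lborel)"
    by (simp add: nn_integral_cmult)
  also have "\<dots> \<le> (\<integral>\<^sup>+x. \<integral>\<^sup>+y. 2 * (F x y * indicator S (x, y))
      + 2 * (ennreal ((u y)\<^sup>2) * (K x y * indicator S (x, y))) \<partial>lborel \<partial>lborel)"
  proof (intro nn_integral_mono)
    fix x y
    \<comment> \<open>The right side minus the left side is the square of
      \<open>u x - 2 * u y\<close>.\<close>
    have "(u x)\<^sup>2 \<le> 2 * (u x - u y)\<^sup>2 + 2 * (u y)\<^sup>2"
      using zero_le_power2[of "u x - 2 * u y"] by (simp add: power2_eq_square algebra_simps)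
    then have "ennreal ((u x)\<^sup>2) \<le> 2 * ennreal ((u x - u y)\<^sup>2) + 2 * ennreal ((u y)\<^sup>2)"
      by (simp add: ennreal_leI flip: ennreal_numeral ennreal_mult' ennreal_plus)
    from mult_right_mono[OF this, of "K x y * indicator S (x, y)"]
    show "ennreal ((u x)\<^sup>2) * (K x y * indicator S (x, y)) \<le> 2 * (F x y * indicator S (x, y))
        + 2 * (ennreal ((u y)\<^sup>2) * (K x y * indicator S (x, y)))"
      by (simp add: F distrib_right mult.assoc)
  qed
  also have "\<dots> = 2 * (\<integral>\<^sup>+x. \<integral>\<^sup>+y. F x y * indicator S (x, y) \<partial>lborel \<partial>lborel)
      + 2 * (\<integral>\<^sup>+x. \<integral>\<^sup>+y. ennreal ((u y)\<^sup>2) * (K x y * indicator S (x, y)) \<partial>lborel \<partial>lborel)"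
    by (simp add: nn_integral_add nn_integral_cmult)
  finally have P_le: "?P \<le> \<dots>" .
  \<comment> \<open>Integrating in \<open>x\<close> first freezes \<open>y\<close>, so that the
    uniform bound \<open>inner_y\<close> applies.\<close>
  have "(\<integral>\<^sup>+x. \<integral>\<^sup>+y. ennreal ((u y)\<^sup>2) * (K x y * indicator S (x, y)) \<partial>lborel \<partial>lborel)
      = (\<integral>\<^sup>+y. \<integral>\<^sup>+x. ennreal ((u y)\<^sup>2) * (K x y * indicator S (x, y)) \<partial>lborel \<partial>lborel)"
    by (rule lborel_pair.Fubini'[symmetric]) simp
  also have "\<dots> = (\<integral>\<^sup>+y. ennreal ((u y)\<^sup>2) * (\<integral>\<^sup>+x. K x y * indicator S (x, y) \<partial>lborel) \<partial>lborel)"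
    by (simp add: nn_integral_cmult)
  also have "\<dots> \<le> (\<integral>\<^sup>+y. ennreal ((u y)\<^sup>2) * ?A \<partial>lborel)"
    by (rule nn_integral_mono_AE, use AE0 in eventually_elim) (auto intro: mult_left_mono inner_y)
  also have "\<dots> = ?A * ?U"
    by (simp add: nn_integral_multc mult.commute)
  finally have "(\<integral>\<^sup>+x. \<integral>\<^sup>+y. ennreal ((u y)\<^sup>2) * (K x y * indicator S (x, y)) \<partial>lborel \<partial>lborel) \<le> ?A * ?U" .
  with half have "2 * (\<integral>\<^sup>+x. \<integral>\<^sup>+y. F x y * indicator S (x, y) \<partial>lborel \<partial>lborel)
      + 2 * (\<integral>\<^sup>+x. \<integral>\<^sup>+y. ennreal ((u y)\<^sup>2) * (K x y * indicator S (x, y)) \<partial>lborel \<partial>lborel)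
    \<le> ?D + 2 * (?A * ?U)"
    by (intro add_mono mult_left_mono) auto
  with P_le show ?thesis
    unfolding mult.assoc by (rule order_trans)
qed

section \<open>Finiteness of the double integral\<close>

text \<open>Each partial derivative is bounded on the compact support by continuity and vanishes off
  it. The sum of these bounds over the basis controls the operator norm, and the mean value
  inequality concludes.\<close>

lemma differentiable_compact_support_imp_lipschitz:
  fixes u :: "'a::euclidean_space \<Rightarrow> real"
  assumes diff: "\<And>x. u differentiable at x"
    and cont: "\<And>v. continuous_on UNIV (\<lambda>x. frechet_derivative u (at x) v)"
    and supp: "compact (closure {x. u x \<noteq> 0})"
  obtains L where "\<And>x y. \<bar>u x - u y\<bar> \<le> L * norm (x - y)"
proof -
  let ?K = "closure {x. u x \<noteq> 0}"
  have "\<exists>B. \<forall>x. norm (frechet_derivative u (at x) i) \<le> B" for i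
  proof -
    have "bounded ((\<lambda>x. frechet_derivative u (at x) i) ` ?K)"
      by (intro compact_imp_bounded compact_continuous_image supp continuous_on_subset[OF cont]) auto
    then obtain B where B: "B > 0" "\<And>x. x \<in> ?K \<Longrightarrow> norm (frechet_derivative u (at x) i) \<le> B"
      by (auto simp: bounded_pos)
    have "norm (frechet_derivative u (at x) i) \<le> B" if "x \<notin> ?K" for x
    proof -
      have "((\<lambda>_. 0) has_derivative (\<lambda>_. 0)) (at x)"
        by simp
      then have "(u has_derivative (\<lambda>_. 0)) (at x)"
        by (rule has_derivative_transform_within_open[where s = "- ?K"])
          (use that closure_subset[of "{x. u x \<noteq> 0}"] in auto)
      then have "frechet_derivative u (at x) = (\<lambda>_. 0)"
        by (rule frechet_derivative_at[symmetric])
      then show ?thesis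
        using B by simp
    qed
    with B show ?thesis by blast
  qed
  then obtain B where B: "\<And>i x. norm (frechet_derivative u (at x) i) \<le> B i"
    by metis
  define L where "L = (\<Sum>i\<in>Basis. B i)"
  have D: "(u has_derivative frechet_derivative u (at x)) (at x)" for x
    using diff frechet_derivative_works by blast
  have "onorm (frechet_derivative u (at x)) \<le> L" for x
  proof -
    have "onorm (frechet_derivative u (at x)) \<le> (\<Sum>i\<in>Basis. norm (frechet_derivative u (at x) i))"
      by (intro onorm_componentwise has_derivative_bounded_linear[OF D])
    also have "\<dots> \<le> L"
      unfolding L_def by (intro sum_mono B)
    finally show ?thesis .
  qed
  then have "\<bar>u x - u y\<bar> \<le> L * norm (x - y)" for x y
    using differentiable_bound[of UNIV u "\<lambda>x. frechet_derivative u (at x)" L x y] D by auto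
  then show ?thesis
    using that by blast
qed

text \<open>The Lipschitz bound lowers the singularity by two powers of \<open>norm (x - y)\<close>,
  which makes it integrable in \<open>y\<close>, uniformly in \<open>x\<close>. The variable
  \<open>x\<close> is confined to a ball.\<close>

lemma nn_integral_lipschitz_ball_support_finite:
  fixes u :: "'a::euclidean_space \<Rightarrow> real"
  assumes lip: "\<And>x y. \<bar>u x - u y\<bar> \<le> L * norm (x - y)"
    and supp: "\<And>x. u x \<noteq> 0 \<Longrightarrow> norm x \<le> R"
  shows "(\<integral>\<^sup>+x. \<integral>\<^sup>+y. ennreal ((u x - u y)\<^sup>2 / norm (x - y) ^ DIM('a))
        * indicator {..<1} (norm (x - y)) \<partial>lborel \<partial>lborel) < \<infinity>"
proof -
  define g where "g = (\<lambda>z :: 'a. ennreal ((norm z)\<^sup>2 / norm z ^ DIM('a)) * indicator {..<1} (norm z))"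
  have [measurable]: "g \<in> borel_measurable borel"
    unfolding g_def by measurable
  have "(\<integral>\<^sup>+x. \<integral>\<^sup>+y. ennreal ((u x - u y)\<^sup>2 / norm (x - y) ^ DIM('a))
        * indicator {..<1} (norm (x - y)) \<partial>lborel \<partial>lborel)
      \<le> (\<integral>\<^sup>+x. \<integral>\<^sup>+y. indicator (cball 0 (R + 1)) x * (ennreal (L\<^sup>2) * g (x - y)) \<partial>lborel \<partial>lborel)"
  proof (intro nn_integral_mono)
    fix x y :: 'a
    have "(u x - u y)\<^sup>2 \<le> L\<^sup>2 * (norm (x - y))\<^sup>2"
      using power_mono[OF lip[of x y], of 2] by (simp add: power_mult_distrib)
    then have "(u x - u y)\<^sup>2 / norm (x - y) ^ DIM('a) \<le> L\<^sup>2 * ((norm (x - y))\<^sup>2 / norm (x - y) ^ DIM('a))"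
      by (simp add: divide_right_mono)
    \<comment> \<open>The radius is enlarged by 1 because \<open>y\<close> may lie in the support
      while \<open>x\<close> is outside, at distance less than 1.\<close>
    moreover have "u x = 0 \<and> u y = 0" if "norm (x - y) < 1" "\<not> norm x \<le> R + 1"
      using that supp[of x] supp[of y] norm_triangle_ineq2[of x y] by auto
    ultimately show "ennreal ((u x - u y)\<^sup>2 / norm (x - y) ^ DIM('a)) * indicator {..<1} (norm (x - y))
        \<le> indicator (cball 0 (R + 1)) x * (ennreal (L\<^sup>2) * g (x - y))"
      by (auto simp: g_def ennreal_mult'[symmetric] ennreal_leI split: split_indicator)
  qed
  also have "\<dots> = (\<integral>\<^sup>+x. indicator (cball 0 (R + 1)) x * (ennreal (L\<^sup>2) * (\<integral>\<^sup>+z. g z \<partial>lborel)) \<partial>(lborel :: 'a measure))"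
    by (simp add: nn_integral_cmult nn_integral_lborel_reflect)
  also have "\<dots> = emeasure lborel (cball (0 :: 'a) (R + 1)) * (ennreal (L\<^sup>2) * (\<integral>\<^sup>+z. g z \<partial>lborel))"
    by (subst nn_integral_multc) (simp_all add: borel_measurable_indicator)
  also have "\<dots> < \<infinity>"
    using nn_integral_ball_norm_square_over_power[where 'a = 'a] emeasure_compact_finite[of "cball (0 :: 'a) (R + 1)"]
    by (simp add: ennreal_mult_less_top g_def)
  finally show ?thesis .
qed

section \<open>Normalisation of the constant and assembly of the inequality\<close>

text \<open>The constant is 2 divided by the surface area of the unit sphere, which is
  \<open>n\<close> times the volume of the ball. This produces the coefficient 2 of the
  logarithm.\<close>

lemma c_const_unit_ball_vol:
  assumes "n > 0"
  shows "c_const n * (real n * unit_ball_vol (real n)) = 2"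
proof -
  have Gamma_Suc: "Gamma (real n / 2 + 1) = real n / 2 * Gamma (real n / 2)"
    using assms by (intro Gamma_plus1) (auto dest: nonpos_Ints_nonpos)
  have "c_const n * (real n * unit_ball_vol (real n)) = real n * Gamma (real n / 2) / Gamma (real n / 2 + 1)"
    by (simp add: c_const_def unit_ball_vol_def)
  also have "\<dots> = real n / (real n / 2)"
    unfolding Gamma_Suc using assms
    by (intro mult_divide_mult_cancel_right less_imp_neq[symmetric] Gamma_real_pos) simp
  finally show ?thesis
    using assms by simp
qed

theorem proposition1p1:
  fixes \<Omega> :: "'a::euclidean_space set" and u :: "'a \<Rightarrow> real"
  assumes "lipschitz_domain \<Omega>" and "bounded \<Omega>" and "0 \<in> \<Omega>"
    and "u \<in> test_functions \<Omega>"
  shows "2 * (LINT x:\<Omega>|lborel. ln (1 / norm x) * (u x)\<^sup>2) + d_const \<Omega> * (L2_norm_on \<Omega> u)\<^sup>2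
           \<le> (ln_norm \<Omega> u)\<^sup>2"
proof -
  define n where "n = DIM('a)"
  have n: "n \<ge> 1"
    using DIM_positive[where 'a = 'a] by (simp add: n_def)
  define b where "b = (5/2 :: real)"
  define w where "w = unit_ball_vol (real n)"
  define c where "c = c_const n"
  \<comment> \<open>This is \<open>2 * c * w / (b - 1) ^ n\<close>, the Apollonius term of
    \<open>nn_log_hardy\<close> scaled by \<open>c\<close>, with \<open>c * w = 2 / n\<close> and
    \<open>b - 1 = 3/2\<close>.\<close>
  define \<epsilon> where "\<epsilon> = 4 / real n * (2/3) ^ n"
  have cw: "c * (real n * w) = 2"
    using n c_const_unit_ball_vol[of n] by (simp add: c_def w_def)
  have c: "c > 0"
    using n by (simp add: c_def c_const_def Gamma_real_pos)
  have w: "w > 0"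
    by (simp add: w_def)
  have Ck: "Ck 0 u" "Ck (Suc 0) u" and supp: "compact (closure {x. u x \<noteq> 0})"
    and sub: "closure {x. u x \<noteq> 0} \<subseteq> \<Omega>"
    using assms(4) by (auto simp: test_functions_def smooth_def simp del: Ck.simps)
  have u_cont: "continuous_on UNIV u"
    using Ck(1) by simp
  then have [measurable]: "u \<in> borel_measurable borel"
    by (rule borel_measurable_continuous_onI)
  have outside: "u x = 0" if "x \<notin> \<Omega>" for x
    using that sub closure_subset[of "{x. u x \<noteq> 0}"] by auto
  obtain L where lip: "\<And>x y. \<bar>u x - u y\<bar> \<le> L * norm (x - y)"
    using differentiable_compact_support_imp_lipschitz[OF _ _ supp] Ck(2) by auto
  obtain R where R: "\<And>x. u x \<noteq> 0 \<Longrightarrow> norm x \<le> R"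
    using compact_imp_bounded[OF supp] closure_subset[of "{x. u x \<noteq> 0}"] by (auto simp: bounded_iff)

  define U where "U = (\<integral>x. (u x)\<^sup>2 \<partial>lborel)"
  have U_int: "integrable lborel (\<lambda>x. (u x)\<^sup>2)"
  proof -
    have "integrable lborel (\<lambda>x. indicator (closure {x. u x \<noteq> 0}) x *\<^sub>R (u x)\<^sup>2)"
      by (intro borel_integrable_compact supp continuous_intros continuous_on_subset[OF u_cont]) auto
    moreover have "(\<lambda>x. indicator (closure {x. u x \<noteq> 0}) x *\<^sub>R (u x)\<^sup>2) = (\<lambda>x. (u x)\<^sup>2)"
      using closure_subset[of "{x. u x \<noteq> 0}"] by (auto simp: indicator_def fun_eq_iff)
    ultimately show ?thesis by simp
  qed
  have U_nn: "(\<integral>\<^sup>+x. ennreal ((u x)\<^sup>2) \<partial>lborel) = ennreal U"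
    unfolding U_def by (rule nn_integral_eq_integral[OF U_int]) simp
  have U_nonneg: "U \<ge> 0"
    by (simp add: U_def)
  have U_\<Omega>: "(LINT x:\<Omega>|lborel. (u x)\<^sup>2) = U"
    unfolding U_def set_lebesgue_integral_def
    by (intro Bochner_Integration.integral_cong) (auto simp: outside split: split_indicator)
  then have L2: "(L2_norm_on \<Omega> u)\<^sup>2 = U"
    using U_nonneg by (simp add: L2_norm_on_def)

  define D where "D = (LINT (x, y):{(x, y). norm (x - y) < 1}|lborel \<Otimes>\<^sub>M lborel.
                (u x - u y)\<^sup>2 / norm (x - y) ^ DIM('a))"
  define G where "G = (\<lambda>(x, y). (u x - u y)\<^sup>2 / norm (x - y) ^ DIM('a) * indicator {..<1} (norm (x - y)))"
  have [measurable]: "G \<in> borel_measurable (borel \<Otimes>\<^sub>M borel)"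
    unfolding G_def by measurable
  have G_nonneg: "G p \<ge> 0" for p
    by (auto simp: G_def split: prod.splits)
  have D_G: "D = (\<integral>p. G p \<partial>(lborel \<Otimes>\<^sub>M lborel))"
    unfolding D_def set_lebesgue_integral_def
    by (intro Bochner_Integration.integral_cong) (auto simp: G_def split: split_indicator)
  have "(\<integral>\<^sup>+p. ennreal (G p) \<partial>(lborel \<Otimes>\<^sub>M lborel)) = (\<integral>\<^sup>+x. \<integral>\<^sup>+y. ennreal (G (x, y)) \<partial>lborel \<partial>lborel)"
    by (subst lborel.nn_integral_fst) simp_all
  also have "\<dots> = (\<integral>\<^sup>+x. \<integral>\<^sup>+y. ennreal ((u x - u y)\<^sup>2 / norm (x - y) ^ DIM('a))
        * indicator {..<1} (norm (x - y)) \<partial>lborel \<partial>lborel)"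
    by (intro nn_integral_cong) (auto simp: G_def split: split_indicator)
  finally have G_nn: "(\<integral>\<^sup>+p. ennreal (G p) \<partial>(lborel \<Otimes>\<^sub>M lborel)) = \<dots>" .
  \<comment> \<open>Finiteness ensures that the Bochner integral in \<open>ln_norm\<close> is the
    true value and not the default 0 of a non-integrable function.\<close>
  then have "(\<integral>\<^sup>+p. ennreal (G p) \<partial>(lborel \<Otimes>\<^sub>M lborel)) < \<infinity>"
    using nn_integral_lipschitz_ball_support_finite[of u L R] lip R by simp
  then have "integrable (lborel \<Otimes>\<^sub>M lborel) G"
    using G_nonneg by (intro integrableI_nonneg) auto
  then have D_nn: "(\<integral>\<^sup>+x. \<integral>\<^sup>+y. ennreal ((u x - u y)\<^sup>2 / norm (x - y) ^ DIM('a))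
        * indicator {..<1} (norm (x - y)) \<partial>lborel \<partial>lborel) = ennreal D"
    unfolding G_nn[symmetric] D_G using G_nonneg by (intro nn_integral_eq_integral) auto
  have D_nonneg: "D \<ge> 0"
    unfolding D_G using G_nonneg by (intro integral_nonneg_AE) auto
  have ln_norm: "(ln_norm \<Omega> u)\<^sup>2 = c * D + U"
    unfolding ln_norm_def U_\<Omega> D_def[symmetric] c_def[unfolded n_def, symmetric]
    using c D_nonneg U_nonneg by simp

  define q where "q = w / (b - 1) ^ n"
  have q: "q \<ge> 0"
    using w by (simp add: q_def b_def)
  \<comment> \<open>The left-hand integrand of \<open>nn_log_hardy\<close> multiplied by
    \<open>c\<close>; the factor 2 is \<open>c * (n * w)\<close>.\<close>
  define h where "h = (\<lambda>x. (u x)\<^sup>2 * (2 * max 0 (ln (1 / (b * norm x)))))"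
  have [measurable]: "h \<in> borel_measurable borel"
    unfolding h_def by measurable
  have h_nonneg: "h x \<ge> 0" for x
    by (simp add: h_def)
  have "(\<integral>\<^sup>+x. ennreal (h x) \<partial>lborel)
      = (\<integral>\<^sup>+x. ennreal c * (ennreal ((u x)\<^sup>2) * ennreal (real n * w * max 0 (ln (1 / (b * norm x))))) \<partial>lborel)"
  proof (rule nn_integral_cong)
    fix x
    have "h x = c * (real n * w) * ((u x)\<^sup>2 * max 0 (ln (1 / (b * norm x))))"
      unfolding cw by (simp add: h_def)
    also have "\<dots> = c * ((u x)\<^sup>2 * (real n * w * max 0 (ln (1 / (b * norm x)))))"
      by (simp only: mult_ac)
    finally show "ennreal (h x) = ennreal c * (ennreal ((u x)\<^sup>2) * ennreal (real n * w * max 0 (ln (1 / (b * norm x)))))"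
      using c w by (simp add: ennreal_mult)
  qed
  also have "\<dots> = ennreal c * (\<integral>\<^sup>+x. ennreal ((u x)\<^sup>2) * ennreal (real n * w * max 0 (ln (1 / (b * norm x)))) \<partial>lborel)"
    by (rule nn_integral_cmult) simp
  also have "\<dots> \<le> ennreal c * (ennreal D + 2 * ennreal q * ennreal U)"
    using nn_log_hardy[of u b] unfolding D_nn U_nn q_def w_def n_def
    by (intro mult_left_mono) (auto simp: b_def)
  also have "\<dots> = ennreal (c * (D + 2 * q * U))"
    using c D_nonneg U_nonneg q
    by (simp add: ennreal_mult flip: ennreal_numeral)
  also have "c * (D + 2 * q * U) = c * D + \<epsilon> * U"
  proof -
    have "c * w = 2 / real n"
      using cw n by (simp add: field_simps)
    moreover have "1 / (b - 1) ^ n = (2/3) ^ n"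
      by (simp add: b_def power_divide)
    ultimately have "2 * (c * w) * (1 / (b - 1) ^ n) = \<epsilon>"
      by (simp add: \<epsilon>_def)
    then have "c * (2 * q) = \<epsilon>"
      by (simp add: q_def mult_ac)
    then show ?thesis
      by (simp add: distrib_left flip: mult.assoc)
  qed
  finally have h_nn: "(\<integral>\<^sup>+x. ennreal (h x) \<partial>lborel) \<le> ennreal (c * D + \<epsilon> * U)" .
  have h_int: "integrable lborel h"
    using h_nn h_nonneg by (intro integrableI_nonneg) (auto intro: le_less_trans)
  have h_le: "(\<integral>x. h x \<partial>lborel) \<le> c * D + \<epsilon> * U"
  proof -
    have "0 \<le> c * D + \<epsilon> * U"
      using c D_nonneg U_nonneg by (simp add: \<epsilon>_def)
    then show ?thesis
      using h_nn h_nonneg by (subst (asm) nn_integral_eq_integral[OF h_int]) auto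
  qed

  have "2 * (LINT x:\<Omega>|lborel. ln (1 / norm x) * (u x)\<^sup>2)
      = (\<integral>x. 2 * (indicator \<Omega> x *\<^sub>R (ln (1 / norm x) * (u x)\<^sup>2)) \<partial>lborel)"
    unfolding set_lebesgue_integral_def by simp
  also have "\<dots> \<le> (\<integral>x. h x + 2 * ln b * (u x)\<^sup>2 \<partial>lborel)"
  \<comment> \<open>This rule asks for integrability and nonnegativity of the majorant only, so the
    signed logarithmic integrand is compared directly.\<close>
  proof (rule integral_mono')
    show "integrable lborel (\<lambda>x. h x + 2 * ln b * (u x)\<^sup>2)"
      using h_int U_int by simp
    fix x :: 'a
    have ln_b: "ln b \<ge> 0"
      by (simp add: b_def)
    then show nonneg: "0 \<le> h x + 2 * ln b * (u x)\<^sup>2"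
      using h_nonneg by simp
    \<comment> \<open>Rescaling by \<open>b\<close> costs \<open>ln b\<close>, and truncation only
      increases the right side. At \<open>x = 0\<close> both quotients are 0 by convention, so the
      two logarithms coincide.\<close>
    have "ln (1 / norm x) \<le> max 0 (ln (1 / (b * norm x))) + ln b"
    proof (cases "x = 0")
      case False
      then have "ln (1 / norm x) = ln (1 / (b * norm x)) + ln b"
        by (simp add: b_def ln_div ln_mult)
      then show ?thesis by simp
    qed (use ln_b in simp)
    from mult_left_mono[OF this, of "2 * (u x)\<^sup>2"]
    have "2 * (ln (1 / norm x) * (u x)\<^sup>2) \<le> h x + 2 * ln b * (u x)\<^sup>2"
      by (simp add: h_def algebra_simps)
    with nonneg show "2 * (indicator \<Omega> x *\<^sub>R (ln (1 / norm x) * (u x)\<^sup>2)) \<le> h x + 2 * ln b * (u x)\<^sup>2"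
      by (simp split: split_indicator)
  qed
  also have "\<dots> = (\<integral>x. h x \<partial>lborel) + 2 * ln b * U"
    unfolding U_def using h_int U_int by simp
  also have "\<dots> \<le> c * D + (2 * ln b + \<epsilon>) * U"
    using h_le by (simp add: algebra_simps)
  finally have main: "2 * (LINT x:\<Omega>|lborel. ln (1 / norm x) * (u x)\<^sup>2) \<le> c * D + (2 * ln b + \<epsilon>) * U" .
  \<comment> \<open>The volume term enters \<open>d_const\<close> with a minus sign, so its
    nonnegativity bounds \<open>d_const\<close> by the Digamma part.\<close>
  have "C_const TYPE('a) \<ge> 0"
    unfolding C_const_def n_def[symmetric] c_def[symmetric]
    using c by (intro mult_nonneg_nonneg) (auto simp: set_lebesgue_integral_def intro!: integral_nonneg_AE)
  then have "C_const TYPE('a) * sqrt (measure lborel \<Omega>) \<ge> 0"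
    by simp
  then have "d_const \<Omega> \<le> 1 - (2 * ln b + \<epsilon>)"
    using Digamma_double_minus_ge_ln[OF n] by (simp add: d_const_def b_def \<epsilon>_def n_def)
  then have "d_const \<Omega> * U \<le> (1 - (2 * ln b + \<epsilon>)) * U"
    using U_nonneg by (rule mult_right_mono)
  \<comment> \<open>The coefficients of \<open>U\<close> in the two bounds add up to 1, leaving
    exactly \<open>c * D + U\<close>.\<close>
  with main show ?thesis
    unfolding L2 ln_norm by (simp add: algebra_simps)
qed

end
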